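(* Let $R$ be a hyperring. Every primary hyperideal of $R$ is a 2-absorbing primary hyperideal of $R$.
   Context: A hyperoperation on a set $R$ is a map $\cdot:R\times R\to P^*(R)$, where $P^*(R)$ is the set of nonempty subsets of $R$. For subsets $A,B$ of $R$ and $a\in R$, $A\cdot B=\bigcup_{x\in A,y\in B}x\cdot y$ and $a\cdot B=\{a\}\cdot B$; longer products are formed in the same way, and $x^n$ is the $n$-fold hyperproduct ($x^1=\{x\}$). A multiplicative hyperring $(R,+,\cdot)$ consists of an abelian group $(R,+)$ and an associative hyperoperation $\cdot$ such that for all $x,y,z$: $x\cdot(y+z)\subseteq x\cdot y+x\cdot z$, $(y+z)\cdot x\subseteq y\cdot x+z\cdot x$, and $x\cdot(-y)=(-x)\cdot y=-(x\cdot y)$ (sums and negatives of sets are elementwise). "Hyperring" means a multiplicative hyperring that is commutative ($x\cdot y=y\cdot x$), proper (it is not a ring, i.e. some $x\cdot y$ is not a singleton), and has absorbing zero ($0\in x\cdot 0=0\cdot x$ for all $x$). A hyperideal of $R$ is a nonempty subset $I$ with $x-y\in I$ and $r\cdot x\subseteq I$ for all $x,y\in I$, $r\in R$. The radical is $\sqrt I=\{r\in R: r^n\subseteq I\text{ for some integer }n\ge1\}$. A proper hyperideal $Q$ ($Q\neq R$) is primary if for all $x,y\in R$, $x\cdot y\subseteq Q$ implies $x\in Q$ or $y\in\sqrt Q$. A proper hyperideal $I$ is 2-absorbing primary if for all $a,b,c\in R$, $a\cdot b\cdot c\subseteq I$ implies $a\cdot b\subseteq I$ or $b\cdot c\subseteq\sqrt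 I$ or $a\cdot c\subseteq\sqrt I$. *)

theory Defs
  imports Main "HOL-Library.Set_Algebras"
begin

text \<open>
  The underlying abelian group \<open>(R, +)\<close> is a type of class \<open>ab_group_add\<close>; a hyperoperation
  is a function into sets whose values are required to be nonempty. Sums of sets are the
  elementwise sums of \<open>Set_Algebras\<close>.
\<close>

definition set_hprod :: "('a \<Rightarrow> 'a \<Rightarrow> 'a set) \<Rightarrow> 'a set \<Rightarrow> 'a set \<Rightarrow> 'a set" where
  "set_hprod hm A B = (\<Union>x\<in>A. \<Union>y\<in>B. hm x y)"

locale multiplicative_hyperring =
  fixes hm :: "'a::ab_group_add \<Rightarrow> 'a \<Rightarrow> 'a set"
  assumes nonempty: "hm x y \<noteq> {}"
    and assoc: "set_hprod hm (hm x y) {z} = set_hprod hm {x} (hm y z)"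
    and distrib_left_subset: "hm x (y + z) \<subseteq> hm x y + hm x z"
    and distrib_right_subset: "hm (y + z) x \<subseteq> hm y x + hm z x"
    and minus_right: "hm x (- y) = uminus ` hm x y"
    and minus_left: "hm (- x) y = uminus ` hm x y"

locale hyperring = multiplicative_hyperring +
  assumes commute: "hm x y = hm y x"
    and not_ring: "\<exists>x y. \<nexists>z. hm x y = {z}"
    and zero_absorbing: "0 \<in> hm x 0" "hm x 0 = hm 0 x"

text \<open>The exponent \<open>0\<close> is deliberately left unspecified, as hyperrings need not have a unit.\<close>

fun hpower :: "('a \<Rightarrow> 'a \<Rightarrow> 'a set) \<Rightarrow> 'a \<Rightarrow> nat \<Rightarrow> 'a set" where
  "hpower hm x (Suc 0) = {x}"
| "hpower hm x (Suc (Suc n)) = set_hprod hm (hpower hm x (Suc n)) {x}"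

definition hyperideal :: "('a::ab_group_add \<Rightarrow> 'a \<Rightarrow> 'a set) \<Rightarrow> 'a set \<Rightarrow> bool" where
  "hyperideal hm I \<longleftrightarrow>
     I \<noteq> {} \<and> (\<forall>x\<in>I. \<forall>y\<in>I. x - y \<in> I) \<and> (\<forall>r. \<forall>x\<in>I. hm r x \<subseteq> I)"

definition hradical :: "('a \<Rightarrow> 'a \<Rightarrow> 'a set) \<Rightarrow> 'a set \<Rightarrow> 'a set" where
  "hradical hm I = {r. \<exists>n\<ge>1. hpower hm r n \<subseteq> I}"

definition primary_hyperideal :: "('a::ab_group_add \<Rightarrow> 'a \<Rightarrow> 'a set) \<Rightarrow> 'a set \<Rightarrow> bool" where
  "primary_hyperideal hm Q \<longleftrightarrow>
     hyperideal hm Q \<and> Q \<noteq> UNIV \<and>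
     (\<forall>x y. hm x y \<subseteq> Q \<longrightarrow> x \<in> Q \<or> y \<in> hradical hm Q)"

definition two_absorbing_primary_hyperideal ::
    "('a::ab_group_add \<Rightarrow> 'a \<Rightarrow> 'a set) \<Rightarrow> 'a set \<Rightarrow> bool" where
  "two_absorbing_primary_hyperideal hm I \<longleftrightarrow>
     hyperideal hm I \<and> I \<noteq> UNIV \<and>
     (\<forall>a b c. set_hprod hm (hm a b) {c} \<subseteq> I \<longrightarrow>
        hm a b \<subseteq> I \<or> hm b c \<subseteq> hradical hm I \<or> hm a c \<subseteq> hradical hm I)"

end

theory Submission
  imports Defs
begin

text \<open>
  Suppose \<open>a \<cdot> b \<cdot> c \<subseteq> Q\<close> but some \<open>u \<in> a \<cdot> b\<close> lies outside \<open>Q\<close>. Then \<open>u \<cdot> c \<subseteq> Q\<close>, so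
  primariness puts \<open>c\<close> into the radical of \<open>Q\<close>. It remains to see that the radical absorbs
  products, so that it contains \<open>b \<cdot> c\<close>. For \<open>t \<in> b \<cdot> c\<close>, commutativity and associativity give
  \<open>t\<^sup>n \<subseteq> R \<cdot> c\<^sup>n\<close> (lemma \<open>hpower_subset_multiples\<close>), and \<open>R \<cdot> c\<^sup>n \<subseteq> Q\<close> as soon as \<open>c\<^sup>n \<subseteq> Q\<close>.
\<close>

context hyperring
begin

lemma hm_assoc_right:
  assumes "u \<in> hm x y" "v \<in> hm u z"
  obtains w where "w \<in> hm y z" "v \<in> hm x w"
proof -
  have "v \<in> set_hprod hm (hm x y) {z}"
    using assms by (auto simp: set_hprod_def)
  then show ?thesis
    using that by (auto simp: assoc) (auto simp: set_hprod_def)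
qed

lemma hm_assoc_left:
  assumes "w \<in> hm y z" "v \<in> hm x w"
  obtains u where "u \<in> hm x y" "v \<in> hm u z"
proof -
  have "v \<in> set_hprod hm {x} (hm y z)"
    using assms by (auto simp: set_hprod_def)
  then show ?thesis
    using that by (auto simp: assoc [symmetric]) (auto simp: set_hprod_def)
qed

text \<open>The element form of \<open>(r \<cdot> s) \<cdot> (b \<cdot> c) \<subseteq> (r \<cdot> b) \<cdot> (s \<cdot> c)\<close>.\<close>

lemma hm_exchange:
  assumes "w \<in> hm r s" "t \<in> hm b c" "v \<in> hm w t"
  obtains p q where "p \<in> hm r b" "q \<in> hm s c" "v \<in> hm p q"
proof -
  obtain k where k: "k \<in> hm s t" "v \<in> hm r k"
    using hm_assoc_right assms(1,3) .
  have "t \<in> hm c b"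
    using assms(2) commute by simp
  then obtain q where q: "q \<in> hm s c" "k \<in> hm q b"
    using hm_assoc_left k(1) by blast
  have "k \<in> hm b q"
    using q(2) commute by simp
  then obtain p where "p \<in> hm r b" "v \<in> hm p q"
    using hm_assoc_left k(2) by blast
  then show ?thesis
    using q(1) that by blast
qed

text \<open>
  By commutativity \<open>t\<^sup>n \<subseteq> b\<^sup>n \<cdot> c\<^sup>n\<close>. Only the factor \<open>c\<^sup>n\<close> matters for membership in a
  hyperideal, and forgetting that the cofactor lies in \<open>b\<^sup>n\<close> leaves a single power to track
  in the induction.
\<close>

lemma hpower_subset_multiples:
  assumes t: "t \<in> hm b c"
  shows "hpower hm t (Suc n) \<subseteq> set_hprod hm UNIV (hpower hm c (Suc n))"
proof (induction n)
  case 0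
  show ?case
    using t by (auto simp: set_hprod_def)
next
  case (Suc n)
  show ?case
  proof
    fix v assume "v \<in> hpower hm t (Suc (Suc n))"
    then obtain w where w: "w \<in> hpower hm t (Suc n)" "v \<in> hm w t"
      by (auto simp: set_hprod_def)
    then obtain r s where s: "s \<in> hpower hm c (Suc n)" "w \<in> hm r s"
      using Suc.IH by (auto simp: set_hprod_def)
    obtain p q where "q \<in> hm s c" "v \<in> hm p q"
      using hm_exchange s(2) t w(2) by blast
    then show "v \<in> set_hprod hm UNIV (hpower hm c (Suc (Suc n)))"
      using s(1) by (auto simp: set_hprod_def)
  qed
qed

lemma hradical_absorbs:
  assumes I: "hyperideal hm I" and c: "c \<in> hradical hm I"
  shows "hm b c \<subseteq> hradical hm I"
proof
  fix t assume t: "t \<in> hm b c"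
  obtain n where n: "hpower hm c (Suc n) \<subseteq> I"
    using c by (auto simp: hradical_def Suc_le_eq gr0_conv_Suc)
  have "hpower hm t (Suc n) \<subseteq> set_hprod hm UNIV (hpower hm c (Suc n))"
    by (rule hpower_subset_multiples [OF t])
  also have "\<dots> \<subseteq> I"
    using I n by (fastforce simp: set_hprod_def hyperideal_def)
  finally show "t \<in> hradical hm I"
    unfolding hradical_def by (intro CollectI exI [of _ "Suc n"]) simp
qed

end

theorem mainTheorem4:
  fixes hm :: "'a::ab_group_add \<Rightarrow> 'a \<Rightarrow> 'a set" and Q :: "'a set"
  assumes "hyperring hm"
    and "primary_hyperideal hm Q"
  shows "two_absorbing_primary_hyperideal hm Q"
proof -
  interpret hyperring hm by fact
  have Q: "hyperideal hm Q" "Q \<noteq> UNIV"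
    and primary: "\<And>x y. hm x y \<subseteq> Q \<Longrightarrow> x \<in> Q \<or> y \<in> hradical hm Q"
    using assms(2) by (auto simp: primary_hyperideal_def)
  have "hm b c \<subseteq> hradical hm Q"
    if abc: "set_hprod hm (hm a b) {c} \<subseteq> Q" and ab: "\<not> hm a b \<subseteq> Q" for a b c
  proof -
    obtain u where u: "u \<in> hm a b" "u \<notin> Q"
      using ab by blast
    have "hm u c \<subseteq> Q"
      using abc u(1) by (auto simp: set_hprod_def)
    then have "c \<in> hradical hm Q"
      using primary u(2) by blast
    then show ?thesis
      by (rule hradical_absorbs [OF Q(1)])
  qed
  then show ?thesis
    using Q unfolding two_absorbing_primary_hyperideal_def by blast
qed

end
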